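(* Let $a,b,p,q,x\in\mathbb{R}$ and let $0\le\alpha\le 1$. Let $f(z)=z+\sum_{n=2}^{\infty}a_nz^n$ belong to the class $\mathcal{L}_{\Sigma}(\alpha,x)$. Put $$D=\left[(\alpha^2-3\alpha+4)b-2p(2-\alpha)^2\right]bx^2-2qa(2-\alpha)^2 .$$ Then $$|a_2|\le \frac{|bx|\sqrt{2|bx|}}{\sqrt{|D|}},\qquad |a_3|\le \frac{|bx|}{6-4\alpha}+\frac{b^2x^2}{(2-\alpha)^2},$$ and for every $\nu\in\mathbb{R}$ $$|a_3-\nu a_2^2|\le \begin{cases}\dfrac{|bx|}{6-4\alpha} & \text{if } |\nu-1|\le \dfrac{|D|}{4b^2x^2(3-2\alpha)},\\[3mm] \dfrac{2|bx|^3\,|\nu-1|}{|D|} & \text{if } |\nu-1|\ge \dfrac{|D|}{4b^2x^2(3-2\alpha)}.\end{cases}$$ Each estimate is asserted whenever the denominators occurring in it (and in its condition) are nonzero.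
   Context: $\Delta=\{z\in\mathbb{C}:|z|<1\}$. $\Sigma$ is the class of bi-univalent functions: analytic functions $f(z)=z+\sum_{n\ge2}a_nz^n$ on $\Delta$ such that $f$ is univalent in $\Delta$ and its inverse $f^{-1}$ (defined near $0$, with expansion $f^{-1}(w)=w-a_2w^2+(2a_2^2-a_3)w^3-\cdots$) extends to a univalent analytic function on $\Delta$, still denoted $f^{-1}$. Subordination: $F\prec G$ means that there is an analytic function $\omega:\Delta\to\Delta$ with $\omega(0)=0$ and $F(z)=G(\omega(z))$ for $z\in\Delta$. For real $a,b,p,q,x$, the generating function of the Horadam polynomials is $$\Pi(x,z)=\frac{a+(b-ap)xz}{1-pxz-qz^2}=a+bxz+(pbx^2+qa)z^2+\cdots .$$ The class $\mathcal{L}_{\Sigma}(\alpha,x)$ (depending also on $a,b,p,q$) consists of all $f\in\Sigma$ such that, with $g=f^{-1}$, $$\left(\frac{zf'(z)}{f(z)}\right)^{\alpha}\left(1+\frac{zf''(z)}{f'(z)}\right)^{1-\alpha}\prec \Pi(x,z)+1-a$$ and $$\left(\frac{wg'(w)}{g(w)}\right)^{\alpha}\left(1+\frac{wg''(w)}{g'(w)}\right)^{1-\alpha}\prec \Pi(x,w)+1-a\qquad(z,w\in\Delta).$$ Here the quotients are given their limit value $1$ at the origin, powers are the branches taking the value $1$ at the origin (a power with exponent $0$ is identically $1$), and the left-hand sides are analytic in $\Delta$.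
   Formalization: The bound on |a_3| is asserted only when bx ≠ 0 or qa = 0; for bx = 0, qa ≠ 0 it is false, e.g. α=1, x=0, a=q=1, f(z)=z/√(1−z²) has a_3=1/2 while the bound is 0. *)

theory Defs
  imports "HOL-Complex_Analysis.Complex_Analysis"
begin

definition univalent :: "(complex \<Rightarrow> complex) \<Rightarrow> bool" where
  "univalent f \<longleftrightarrow> f holomorphic_on ball 0 1 \<and> inj_on f (ball 0 1)"

(* g is the univalent extension to the unit disc of the local inverse of f at 0.
   By the identity theorem g is unique on the disc. *)
definition inverse_extension :: "(complex \<Rightarrow> complex) \<Rightarrow> (complex \<Rightarrow> complex) \<Rightarrow> bool" where
  "inverse_extension f g \<longleftrightarrow> univalent g \<and> (\<forall>\<^sub>F z in nhds 0. g (f z) = z)"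

definition bi_univalent :: "(complex \<Rightarrow> complex) \<Rightarrow> bool" where
  "bi_univalent f \<longleftrightarrow>
     univalent f \<and> f 0 = 0 \<and> deriv f 0 = 1 \<and> (\<exists>g. inverse_extension f g)"

definition subordinate :: "(complex \<Rightarrow> complex) \<Rightarrow> (complex \<Rightarrow> complex) \<Rightarrow> bool" where
  "subordinate F G \<longleftrightarrow>
     (\<exists>\<omega>. \<omega> holomorphic_on ball 0 1 \<and> \<omega> ` ball 0 1 \<subseteq> ball 0 1 \<and> \<omega> 0 = 0 \<and>
          (\<forall>z\<in>ball 0 1. F z = G (\<omega> z)))"

(* remove_sings only matters where the denominator vanishes: if the numerator cancels the zero,
   the value is the limit of the quotient rather than the default value of division by zero.
   At a genuine pole the value is irrelevant: F = G o \<omega> with F continuous cannot hold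
   if \<omega> takes a pole of G as a value. *)
definition horadam_gf :: "real \<Rightarrow> real \<Rightarrow> real \<Rightarrow> real \<Rightarrow> real \<Rightarrow> complex \<Rightarrow> complex" where
  "horadam_gf a b p q x =
     remove_sings (\<lambda>z. (of_real a + of_real ((b - a * p) * x) * z) /
                       (1 - of_real (p * x) * z - of_real q * z\<^sup>2))"

definition starlike_quotient :: "(complex \<Rightarrow> complex) \<Rightarrow> complex \<Rightarrow> complex" where
  "starlike_quotient f z = (if z = 0 then 1 else z * deriv f z / f z)"

definition convex_quotient :: "(complex \<Rightarrow> complex) \<Rightarrow> complex \<Rightarrow> complex" where
  "convex_quotient f z = 1 + z * deriv (deriv f) z / deriv f z"

(* F is the product (z f' / f)^\<alpha> * (1 + z f'' / f')^(1 - \<alpha>) as an analytic function on the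
   disc. Both quotients are 1 at the origin, so near the origin the branches with value 1 there
   are the principal powers; by the identity theorem this germ determines F on the whole disc.
   (The principal powers themselves may be discontinuous away from the origin.) *)
definition power_product :: "real \<Rightarrow> (complex \<Rightarrow> complex) \<Rightarrow> (complex \<Rightarrow> complex) \<Rightarrow> bool" where
  "power_product \<alpha> f F \<longleftrightarrow>
     F holomorphic_on ball 0 1 \<and>
     (\<forall>\<^sub>F z in nhds 0. F z = starlike_quotient f z powr of_real \<alpha> *
                               convex_quotient f z powr of_real (1 - \<alpha>))"

definition class_L ::
  "real \<Rightarrow> real \<Rightarrow> real \<Rightarrow> real \<Rightarrow> real \<Rightarrow> real \<Rightarrow> (complex \<Rightarrow> complex) set" where
  "class_L a b p q \<alpha> x =
     {f. bi_univalent f \<and>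
         (\<exists>g F G. inverse_extension f g \<and> power_product \<alpha> f F \<and> power_product \<alpha> g G \<and>
            subordinate F (\<lambda>z. horadam_gf a b p q x z + 1 - of_real a) \<and>
            subordinate G (\<lambda>w. horadam_gf a b p q x w + 1 - of_real a))}"

abbreviation taylor_coeff :: "(complex \<Rightarrow> complex) \<Rightarrow> nat \<Rightarrow> complex" where
  "taylor_coeff f n \<equiv> fps_nth (fps_expansion f 0) n"

end

theory Submission
  imports Defs
begin

text \<open>
  Comparing coefficients in the two subordinations, with Schwarz functions
  \<open>\<omega> = c\<^sub>1 z + c\<^sub>2 z\<^sup>2 + \<dots>\<close> and \<open>\<omega>' = d\<^sub>1 w + d\<^sub>2 w\<^sup>2 + \<dots>\<close>, gives \<open>d\<^sub>1 = - c\<^sub>1\<close> (if \<open>b x \<noteq> 0\<close>),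
  and the two second-order equations then have the sum
  \<open>D a\<^sub>2\<^sup>2 = (b x)\<^sup>3 (c\<^sub>2 + d\<^sub>2)\<close> and the difference
  \<open>(12 - 8 \<alpha>) (a\<^sub>3 - a\<^sub>2\<^sup>2) = b x (c\<^sub>2 - d\<^sub>2)\<close>.
  All estimates follow from \<open>\<bar>c\<^sub>i\<bar>, \<bar>d\<^sub>i\<bar> \<le> 1\<close>.
\<close>

unbundle no vec_syntax

section \<open>Low-order coefficients of power series\<close>

lemma fps_mult_nth_2: "(F * G) $ 2 = F $ 0 * G $ 2 + F $ 1 * G $ 1 + F $ 2 * G $ 0"
  by (simp add: fps_mult_nth numeral_2_eq_2)

lemma fps_mult_nth_3:
  "(F * G) $ 3 = F $ 0 * G $ 3 + F $ 1 * G $ 2 + F $ 2 * G $ 1 + F $ 3 * G $ 0"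
  by (simp add: fps_mult_nth numeral_3_eq_3 numeral_2_eq_2)

lemma fps_compose_nth_1:
  fixes F G :: "'a::comm_ring_1 fps"
  shows "(F oo G) $ 1 = F $ 1 * G $ 1"
  by (simp add: fps_compose_nth)

lemma fps_compose_nth_2:
  fixes F G :: "'a::comm_ring_1 fps"
  assumes "G $ 0 = 0"
  shows "(F oo G) $ 2 = F $ 1 * G $ 2 + F $ 2 * (G $ 1)\<^sup>2"
  using assms by (simp add: fps_compose_nth numeral_2_eq_2 fps_mult_nth)

lemma fps_compose_nth_3:
  fixes F G :: "'a::comm_ring_1 fps"
  assumes "G $ 0 = 0"
  shows "(F oo G) $ 3 = F $ 1 * G $ 3 + 2 * F $ 2 * G $ 1 * G $ 2 + F $ 3 * (G $ 1) ^ 3"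
  using assms
  by (simp add: fps_compose_nth numeral_3_eq_3 numeral_2_eq_2 fps_mult_nth algebra_simps)

lemma gbinomial_2: "c gchoose 2 = c * (c - 1) / (2 :: complex)"
  by (simp add: gbinomial_prod_rev numeral_2_eq_2)

lemma has_fps_expansion_nth_0: "f has_fps_expansion F \<Longrightarrow> f 0 = F $ 0"
  by (auto simp: has_fps_expansion_def eval_fps_at_0 dest: eventually_nhds_x_imp_x)

text \<open>Substitute \<open>f z - 1\<close> into the binomial series of
  \<open>(1 + z) powr c\<close>. The constant term 1 of \<open>F\<close> makes the composition
  legitimate and selects the branch of the power with value 1 at the origin.\<close>

lemma has_fps_expansion_powr:
  fixes c :: complex
  assumes "f has_fps_expansion F" "F $ 0 = 1"
  shows "(\<lambda>z. f z powr c) has_fps_expansion (fps_binomial c oo (F - 1))"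
proof -
  have "(\<lambda>z. f z - 1) has_fps_expansion F - 1"
    by (intro fps_expansion_intros assms)
  hence "((\<lambda>z. (1 + z) powr c) \<circ> (\<lambda>z. f z - 1)) has_fps_expansion (fps_binomial c oo (F - 1))"
    using assms(2) by (intro has_fps_expansion_compose has_fps_expansion_binomial_complex) auto
  thus ?thesis by (simp add: o_def)
qed

lemma has_fps_expansion_holomorphic_ball:
  assumes "f holomorphic_on ball 0 1"
  shows "f has_fps_expansion fps_expansion f 0"
  by (intro analytic_at_imp_has_fps_expansion_0)
     (use assms in \<open>auto simp: analytic_at intro!: exI[of _ "ball 0 1"]\<close>)

section \<open>Second-order expansion of the power product\<close>

lemma starlike_quotient_expansion:
  fixes A :: "complex fps"
  assumes A: "f has_fps_expansion A" "A $ 0 = 0" "A $ 1 = 1"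
  obtains B where "starlike_quotient f has_fps_expansion B"
    "B $ 0 = 1" "B $ 1 = A $ 2" "B $ 2 = 2 * A $ 3 - (A $ 2)\<^sup>2"
proof -
  define N where "N = fps_X * fps_deriv A"
  define B where "B = N / A"
  have sA: "subdegree A = 1" using A by (intro subdegreeI) auto
  have N: "N $ 0 = 0" "N $ 1 = 1" "N $ 2 = 2 * A $ 2" "N $ 3 = 3 * A $ 3"
    using A by (auto simp: N_def numeral_2_eq_2 numeral_3_eq_3)
  have sN: "subdegree N = 1" using N by (intro subdegreeI) auto
  have nz: "A \<noteq> 0" "N \<noteq> 0" using A(3) N(2) by auto
  \<comment> \<open>Numerator and denominator both vanish to order exactly 1, so their quotient is
    again a power series; the value 1 prescribed at 0 is the ratio of the leading
    coefficients.\<close>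
  have "(\<lambda>z. if z = 0 then 1 else z * deriv f z / f z) has_fps_expansion B"
    unfolding B_def
  proof (rule has_fps_expansion_divide)
    show "(\<lambda>z. z * deriv f z) has_fps_expansion N"
      unfolding N_def by (intro fps_expansion_intros A)
  qed (use A nz sA sN N in auto)
  moreover have "B * A = N"
    unfolding B_def using nz sA sN N by (intro dvd_div_mult_self) (auto simp: fps_dvd_iff)
  \<comment> \<open>Since \<open>A\<close> starts in degree 1, coefficient n of \<open>B\<close>
    first enters in degree n + 1 of the product; hence degrees 1 to 3 determine coefficients 0 to
    2.\<close>
  hence "(B * A) $ 1 = N $ 1" "(B * A) $ 2 = N $ 2" "(B * A) $ 3 = N $ 3" by auto
  hence "B $ 0 = 1" "B $ 1 = A $ 2" "B $ 2 = 2 * A $ 3 - (A $ 2)\<^sup>2"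
    unfolding fps_mult_nth_2 fps_mult_nth_3 fps_mult_nth_1 N using A
    by (auto simp: algebra_simps power2_eq_square)
  ultimately show ?thesis
    by (intro that[of B]) (auto simp: starlike_quotient_def [abs_def])
qed

text \<open>Here the denominator has constant term 1, so no zero has to be cancelled and the
  coefficients of \<open>B\<close> come from the same degrees of
  \<open>B * A' = A' + N\<close>.\<close>

lemma convex_quotient_expansion:
  fixes A :: "complex fps"
  assumes A: "f has_fps_expansion A" "A $ 1 = 1"
  obtains B where "convex_quotient f has_fps_expansion B"
    "B $ 0 = 1" "B $ 1 = 2 * A $ 2" "B $ 2 = 6 * A $ 3 - 4 * (A $ 2)\<^sup>2"
proof -
  define A' where "A' = fps_deriv A"
  define N where "N = fps_X * fps_deriv A'"
  define B where "B = 1 + N / A'"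
  have A': "A' $ 0 = 1" "A' $ 1 = 2 * A $ 2" "A' $ 2 = 3 * A $ 3"
    using A by (auto simp: A'_def numeral_2_eq_2 numeral_3_eq_3)
  have N: "N $ 0 = 0" "N $ 1 = 2 * A $ 2" "N $ 2 = 6 * A $ 3"
    by (auto simp: N_def A'_def numeral_2_eq_2 numeral_3_eq_3)
  have "deriv f has_fps_expansion A'"
    unfolding A'_def by (intro fps_expansion_intros A)
  hence "(\<lambda>z. 1 + z * deriv (deriv f) z / deriv f z) has_fps_expansion B"
    unfolding B_def N_def using A' by (intro fps_expansion_intros) auto
  moreover have "N / A' * A' = N"
    using A' by (intro dvd_div_mult_self) (auto simp: fps_dvd_iff)
  hence "B * A' = A' + N" by (simp add: B_def algebra_simps)
  hence "(B * A') $ 0 = (A' + N) $ 0" "(B * A') $ 1 = (A' + N) $ 1" "(B * A') $ 2 = (A' + N) $ 2"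
    by auto
  hence "B $ 0 = 1" "B $ 1 = 2 * A $ 2" "B $ 2 = 6 * A $ 3 - 4 * (A $ 2)\<^sup>2"
    unfolding fps_mult_nth_2 fps_mult_nth_1 fps_mult_nth_0 fps_add_nth N A'
    by (auto simp: algebra_simps power2_eq_square)
  ultimately show ?thesis
    by (intro that[of B]) (auto simp: convex_quotient_def [abs_def])
qed

text \<open>Both quotients have constant term 1, so each power is a binomial series in the quotient
  minus 1. Multiplying the two series up to second order and collecting \<open>A $ 3\<close> and the
  square of \<open>A $ 2\<close> gives the stated factors.\<close>

lemma power_product_expansion:
  fixes A E :: "complex fps"
  assumes A: "f has_fps_expansion A" "A $ 0 = 0" "A $ 1 = 1"
    and "power_product \<alpha> f F" and E: "F has_fps_expansion E"
  shows "E $ 1 = of_real (2 - \<alpha>) * A $ 2"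
    and "E $ 2 = of_real (6 - 4 * \<alpha>) * A $ 3 + of_real ((\<alpha>\<^sup>2 + 5 * \<alpha> - 8) / 2) * (A $ 2)\<^sup>2"
proof -
  obtain B where B: "starlike_quotient f has_fps_expansion B"
    "B $ 0 = 1" "B $ 1 = A $ 2" "B $ 2 = 2 * A $ 3 - (A $ 2)\<^sup>2"
    using starlike_quotient_expansion[OF A] .
  obtain C where C: "convex_quotient f has_fps_expansion C"
    "C $ 0 = 1" "C $ 1 = 2 * A $ 2" "C $ 2 = 6 * A $ 3 - 4 * (A $ 2)\<^sup>2"
    using convex_quotient_expansion[OF A(1,3)] .
  define P where "P = (fps_binomial (of_real \<alpha>) oo (B - 1) :: complex fps)"
  define Q where "Q = (fps_binomial (of_real (1 - \<alpha>)) oo (C - 1) :: complex fps)"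
  have "(\<lambda>z. starlike_quotient f z powr of_real \<alpha> * convex_quotient f z powr of_real (1 - \<alpha>))
      has_fps_expansion P * Q"
    unfolding P_def Q_def by (intro has_fps_expansion_mult has_fps_expansion_powr B C)
  moreover have "\<forall>\<^sub>F z in nhds 0. F z =
      starlike_quotient f z powr of_real \<alpha> * convex_quotient f z powr of_real (1 - \<alpha>)"
    using assms(4) unfolding power_product_def by blast
  \<comment> \<open>\<open>F\<close> agrees with the principal powers only near 0, which suffices
    because an expansion depends on the germ alone.\<close>
  ultimately have "F has_fps_expansion P * Q"
    using has_fps_expansion_cong[OF _ refl, THEN iffD2] by metis
  hence E_eq: "E = P * Q" using E fps_expansion_unique_complex by blast
  have P: "P $ 0 = 1" "P $ 1 = of_real \<alpha> * B $ 1"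
    "P $ 2 = of_real \<alpha> * B $ 2 + of_real \<alpha> * (of_real \<alpha> - 1) / 2 * (B $ 1)\<^sup>2"
    using B(2) unfolding P_def
    by (simp_all add: fps_compose_nth_1[unfolded One_nat_def] fps_compose_nth_2 gbinomial_2)
  have Q: "Q $ 0 = 1" "Q $ 1 = of_real (1 - \<alpha>) * C $ 1"
    "Q $ 2 = of_real (1 - \<alpha>) * C $ 2 + of_real (1 - \<alpha>) * (of_real (1 - \<alpha>) - 1) / 2 * (C $ 1)\<^sup>2"
    using C(2) unfolding Q_def
    by (simp_all add: fps_compose_nth_1[unfolded One_nat_def] fps_compose_nth_2 gbinomial_2)
  show "E $ 1 = of_real (2 - \<alpha>) * A $ 2"
    unfolding E_eq fps_mult_nth_1 P Q B C by (simp add: algebra_simps)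
  show "E $ 2 = of_real (6 - 4 * \<alpha>) * A $ 3 + of_real ((\<alpha>\<^sup>2 + 5 * \<alpha> - 8) / 2) * (A $ 2)\<^sup>2"
    unfolding E_eq fps_mult_nth_2 P Q B C by (simp add: field_simps power2_eq_square)
qed

section \<open>Expansion of the Horadam generating function\<close>

lemma horadam_gf_expansion:
  obtains H where "horadam_gf a b p q x has_fps_expansion H"
    "H $ 1 = of_real (b * x)" "H $ 2 = of_real (p * b * x\<^sup>2 + q * a)"
proof -
  define num where "num z = of_real a + of_real ((b - a * p) * x) * z" for z :: complex
  define den where "den z = 1 - of_real (p * x) * z - of_real q * z\<^sup>2" for z :: complex
  define N where "N = fps_const (of_real a) + fps_const (of_real ((b - a * p) * x)) * (fps_X :: complex fps)"
  define M where "M = 1 - fps_const (of_real (p * x)) * fps_X - fps_const (of_real q) * (fps_X :: complex fps)\<^sup>2"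
  define H where "H = N / M"
  have N: "N $ 0 = of_real a" "N $ 1 = of_real ((b - a * p) * x)" "N $ 2 = 0"
    by (simp_all add: N_def fps_X_def)
  have M: "M $ 0 = 1" "M $ 1 = - of_real (p * x)" "M $ 2 = - of_real q"
    by (simp_all add: M_def power2_eq_square numeral_2_eq_2)
  have H: "(\<lambda>z. num z / den z) has_fps_expansion H"
    unfolding H_def num_def den_def using M(1) unfolding N_def M_def
    by (intro fps_expansion_intros) auto
  \<comment> \<open>The quotient is analytic at 0, where \<open>den\<close> equals 1, so removing
    singularities changes nothing near 0.\<close>
  hence "\<forall>\<^sub>F z in nhds 0. horadam_gf a b p q x z = num z / den z"
    unfolding horadam_gf_def num_def den_def
    by (intro eventually_remove_sings_eq_nhds has_fps_expansion_imp_analytic_0)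
  with H have "horadam_gf a b p q x has_fps_expansion H"
    by (simp cong: has_fps_expansion_cong)
  \<comment> \<open>Clearing the denominator yields the Horadam recurrence with factors
    \<open>p * x\<close> and \<open>q\<close>, whose first two terms are \<open>a\<close> and
    \<open>b * x\<close>.\<close>
  moreover have "H * M = N"
    unfolding H_def using M by (intro dvd_div_mult_self) (auto simp: fps_dvd_iff)
  hence "(H * M) $ 0 = N $ 0" "(H * M) $ 1 = N $ 1" "(H * M) $ 2 = N $ 2" by auto
  hence "H $ 1 = of_real (b * x)" "H $ 2 = of_real (p * b * x\<^sup>2 + q * a)"
    unfolding fps_mult_nth_2 fps_mult_nth_1 fps_mult_nth_0 N M
    by (auto simp: algebra_simps power2_eq_square)
  ultimately show ?thesis by (rule that)
qed

section \<open>Schwarz functions and subordination\<close>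

text \<open>Cauchy's inequality on the circle of radius r < 1 bounds the coefficient by
  \<open>1 / r ^ n\<close>; then r tends to 1 from the left.\<close>

lemma norm_taylor_coeff_le_1:
  assumes hol: "\<omega> holomorphic_on ball 0 1" and im: "\<omega> ` ball 0 1 \<subseteq> ball 0 1"
  shows "norm (taylor_coeff \<omega> n) \<le> 1"
proof -
  have le: "norm (taylor_coeff \<omega> n) * r ^ n \<le> 1" if r: "0 < r" "r < 1" for r :: real
  proof -
    have sub: "cball 0 r \<subseteq> ball (0::complex) 1" using r by auto
    have "norm ((deriv ^^ n) \<omega> 0) \<le> fact n * 1 / r ^ n"
    proof (rule Cauchy_inequality)
      show "\<omega> holomorphic_on ball 0 r"
        by (rule holomorphic_on_subset[OF hol]) (use r in auto)
      show "continuous_on (cball 0 r) \<omega>"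
        using holomorphic_on_imp_continuous_on[OF hol] sub continuous_on_subset by blast
      show "norm (\<omega> z) \<le> 1" if "norm (0 - z) = r" for z
        using im that r by (force simp: image_subset_iff dest: bspec[of _ _ z])
    qed fact
    thus ?thesis using r by (simp add: fps_expansion_def norm_divide field_simps)
  qed
  have "((\<lambda>r. norm (taylor_coeff \<omega> n) * r ^ n) \<longlongrightarrow> norm (taylor_coeff \<omega> n) * 1 ^ n) (at_left (1::real))"
    by (intro tendsto_intros)
  moreover have "\<forall>\<^sub>F r in at_left (1::real). norm (taylor_coeff \<omega> n) * r ^ n \<le> 1"
    using eventually_at_left_real[of 0 "1::real"] by (auto elim!: eventually_mono intro: le)
  ultimately show ?thesis
    using tendsto_upperbound[of _ "norm (taylor_coeff \<omega> n) * 1 ^ n" "at_left (1::real)" 1] by simp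
qed

text \<open>The witnesses are the first two Taylor coefficients of the Schwarz function. The shift
  by \<open>1 - c\<close> affects only the constant term.\<close>

lemma subordinate_expansion:
  assumes sub: "subordinate F (\<lambda>z. h z + 1 - c)"
    and F: "F has_fps_expansion E" and h: "h has_fps_expansion H"
  obtains c\<^sub>1 c\<^sub>2 :: complex where "norm c\<^sub>1 \<le> 1" "norm c\<^sub>2 \<le> 1"
    "E $ 1 = H $ 1 * c\<^sub>1" "E $ 2 = H $ 1 * c\<^sub>2 + H $ 2 * c\<^sub>1\<^sup>2"
proof -
  obtain \<omega> where \<omega>: "\<omega> holomorphic_on ball 0 1" "\<omega> ` ball 0 1 \<subseteq> ball 0 1" "\<omega> 0 = 0"
    and eq: "\<And>z. z \<in> ball 0 1 \<Longrightarrow> F z = h (\<omega> z) + 1 - c"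
    using sub unfolding subordinate_def by blast
  define W where "W = fps_expansion \<omega> 0"
  have W: "\<omega> has_fps_expansion W"
    unfolding W_def by (rule has_fps_expansion_holomorphic_ball) fact
  have W0: "W $ 0 = 0" using has_fps_expansion_nth_0[OF W] \<omega>(3) by simp
  have "(h \<circ> \<omega>) has_fps_expansion (H oo W)"
    by (intro fps_expansion_intros h W W0)
  hence "(\<lambda>z. h (\<omega> z) + 1 - c) has_fps_expansion (H oo W) + 1 - fps_const c"
    unfolding o_def by (intro fps_expansion_intros)
  moreover have "\<forall>\<^sub>F z in nhds 0. F z = h (\<omega> z) + 1 - c"
    using eventually_nhds_in_open[of "ball 0 1" "0::complex"] by (auto elim!: eventually_mono intro: eq)
  ultimately have "F has_fps_expansion (H oo W) + 1 - fps_const c"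
    by (simp cong: has_fps_expansion_cong)
  hence "E = (H oo W) + 1 - fps_const c" using F fps_expansion_unique_complex by blast
  hence "E $ 1 = H $ 1 * W $ 1" "E $ 2 = H $ 1 * W $ 2 + H $ 2 * (W $ 1)\<^sup>2"
    using W0 by (simp_all add: fps_compose_nth_1[unfolded One_nat_def] fps_compose_nth_2)
  moreover have "norm (W $ n) \<le> 1" for n
    unfolding W_def by (rule norm_taylor_coeff_le_1) fact+
  ultimately show ?thesis using that by blast
qed

section \<open>Expansion of the inverse function\<close>

text \<open>Because \<open>A $ 1 = 1\<close>, the coefficients of \<open>A' oo A = fps_X\<close>
  form a triangular system, solved degree by degree for \<open>A'\<close>.\<close>

lemma inverse_expansion:
  fixes A A' :: "complex fps"
  assumes f: "f has_fps_expansion A" "A $ 0 = 0" "A $ 1 = 1"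
    and g: "g has_fps_expansion A'" and inv: "\<forall>\<^sub>F z in nhds 0. g (f z) = z"
  shows "A' $ 0 = 0" "A' $ 1 = 1" "A' $ 2 = - A $ 2" "A' $ 3 = 2 * (A $ 2)\<^sup>2 - A $ 3"
proof -
  have "(g \<circ> f) has_fps_expansion (A' oo A)"
    by (intro fps_expansion_intros f g)
  moreover have "(g \<circ> f) has_fps_expansion fps_X"
    using inv has_fps_expansion_fps_X by (simp add: o_def cong: has_fps_expansion_cong)
  ultimately have "A' oo A = fps_X" using fps_expansion_unique_complex by blast
  hence eq: "(A' oo A) $ n = fps_X $ n" for n by simp
  show "A' $ 0 = 0" using eq[of 0] by simp
  show 1: "A' $ 1 = 1" using eq[of 1] f by (simp add: fps_compose_nth_1[unfolded One_nat_def])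
  show 2: "A' $ 2 = - A $ 2"
    using eq[of 2] f 1 by (simp add: fps_compose_nth_2 fps_X_def add_eq_0_iff)
  show "A' $ 3 = 2 * (A $ 2)\<^sup>2 - A $ 3"
    using eq[of 3] f 1 2 by (simp add: fps_compose_nth_3 fps_X_def algebra_simps power2_eq_square)
qed

section \<open>Coefficient equations for the class\<close>

text \<open>The equations for the inverse are those for \<open>f\<close> with
  \<open>a\<^sub>2\<close> and \<open>a\<^sub>3\<close> replaced by \<open>- a\<^sub>2\<close> and
  \<open>2 * a\<^sub>2\<^sup>2 - a\<^sub>3\<close>; the quadratic term is blind to the sign
  change.\<close>

lemma class_L_coeff_equations:
  assumes "f \<in> class_L a b p q \<alpha> x"
  defines "a\<^sub>2 \<equiv> taylor_coeff f 2" and "a\<^sub>3 \<equiv> taylor_coeff f 3"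
  obtains c\<^sub>1 c\<^sub>2 d\<^sub>1 d\<^sub>2 :: complex where
    "norm c\<^sub>1 \<le> 1" "norm c\<^sub>2 \<le> 1" "norm d\<^sub>1 \<le> 1" "norm d\<^sub>2 \<le> 1"
    "of_real (2 - \<alpha>) * a\<^sub>2 = of_real (b * x) * c\<^sub>1"
    "of_real (2 - \<alpha>) * (- a\<^sub>2) = of_real (b * x) * d\<^sub>1"
    "of_real (6 - 4 * \<alpha>) * a\<^sub>3 + of_real ((\<alpha>\<^sup>2 + 5 * \<alpha> - 8) / 2) * a\<^sub>2\<^sup>2 =
       of_real (b * x) * c\<^sub>2 + of_real (p * b * x\<^sup>2 + q * a) * c\<^sub>1\<^sup>2"
    "of_real (6 - 4 * \<alpha>) * (2 * a\<^sub>2\<^sup>2 - a\<^sub>3) + of_real ((\<alpha>\<^sup>2 + 5 * \<alpha> - 8) / 2) * a\<^sub>2\<^sup>2 =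
       of_real (b * x) * d\<^sub>2 + of_real (p * b * x\<^sup>2 + q * a) * d\<^sub>1\<^sup>2"
proof -
  obtain g F G where bi: "bi_univalent f" and g: "inverse_extension f g"
    and F: "power_product \<alpha> f F" and G: "power_product \<alpha> g G"
    and sF: "subordinate F (\<lambda>z. horadam_gf a b p q x z + 1 - of_real a)"
    and sG: "subordinate G (\<lambda>w. horadam_gf a b p q x w + 1 - of_real a)"
    using assms(1) unfolding class_L_def by blast
  define A where "A = fps_expansion f 0"
  define A' where "A' = fps_expansion g 0"
  have A: "f has_fps_expansion A" and A': "g has_fps_expansion A'"
    unfolding A_def A'_def using bi g
    by (auto simp: bi_univalent_def inverse_extension_def univalent_def
             intro!: has_fps_expansion_holomorphic_ball)
  have A01: "A $ 0 = 0" "A $ 1 = 1"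
    using bi by (auto simp: A_def fps_expansion_def bi_univalent_def)
  note inv = inverse_expansion[OF A A01 A']
  have ev: "\<forall>\<^sub>F z in nhds 0. g (f z) = z" using g by (simp add: inverse_extension_def)
  have EF: "F has_fps_expansion fps_expansion F 0" and EG: "G has_fps_expansion fps_expansion G 0"
    using F G by (auto simp: power_product_def intro!: has_fps_expansion_holomorphic_ball)
  obtain H where H: "horadam_gf a b p q x has_fps_expansion H"
    "H $ 1 = of_real (b * x)" "H $ 2 = of_real (p * b * x\<^sup>2 + q * a)"
    by (rule horadam_gf_expansion)
  obtain c\<^sub>1 c\<^sub>2 where c: "norm c\<^sub>1 \<le> 1" "norm c\<^sub>2 \<le> 1"
    "taylor_coeff F 1 = H $ 1 * c\<^sub>1" "taylor_coeff F 2 = H $ 1 * c\<^sub>2 + H $ 2 * c\<^sub>1\<^sup>2"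
    using subordinate_expansion[OF sF EF H(1)] .
  obtain d\<^sub>1 d\<^sub>2 where d: "norm d\<^sub>1 \<le> 1" "norm d\<^sub>2 \<le> 1"
    "taylor_coeff G 1 = H $ 1 * d\<^sub>1" "taylor_coeff G 2 = H $ 1 * d\<^sub>2 + H $ 2 * d\<^sub>1\<^sup>2"
    using subordinate_expansion[OF sG EG H(1)] .
  note pF = power_product_expansion[OF A A01 F EF]
  note pG = power_product_expansion[OF A' inv(1,2)[OF ev] G EG, unfolded inv(3,4)[OF ev]]
  have [simp]: "A $ 2 = a\<^sub>2" "A $ 3 = a\<^sub>3" by (simp_all add: A_def a\<^sub>2_def a\<^sub>3_def)
  show ?thesis
  proof (rule that[OF c(1,2) d(1,2)])
    show "of_real (2 - \<alpha>) * a\<^sub>2 = of_real (b * x) * c\<^sub>1"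
      using pF(1) c(3) H by simp
    show "of_real (2 - \<alpha>) * (- a\<^sub>2) = of_real (b * x) * d\<^sub>1"
      using pG(1) d(3) H by simp
    show "of_real (6 - 4 * \<alpha>) * a\<^sub>3 + of_real ((\<alpha>\<^sup>2 + 5 * \<alpha> - 8) / 2) * a\<^sub>2\<^sup>2 =
       of_real (b * x) * c\<^sub>2 + of_real (p * b * x\<^sup>2 + q * a) * c\<^sub>1\<^sup>2"
      using pF(2) c(4) H by simp
    show "of_real (6 - 4 * \<alpha>) * (2 * a\<^sub>2\<^sup>2 - a\<^sub>3) + of_real ((\<alpha>\<^sup>2 + 5 * \<alpha> - 8) / 2) * a\<^sub>2\<^sup>2 =
       of_real (b * x) * d\<^sub>2 + of_real (p * b * x\<^sup>2 + q * a) * d\<^sub>1\<^sup>2"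
      using pG(2) d(4) H by simp
  qed
qed

section \<open>Coefficient bounds and the Fekete-Szego inequality\<close>

theorem theorem2p3:
  fixes a b p q x \<alpha> D :: real and f :: "complex \<Rightarrow> complex" and a\<^sub>2 a\<^sub>3 :: complex
  assumes "0 \<le> \<alpha>" and "\<alpha> \<le> 1"
    and "f \<in> class_L a b p q \<alpha> x"
    and "a\<^sub>2 = taylor_coeff f 2" and "a\<^sub>3 = taylor_coeff f 3"
    and "D = ((\<alpha>\<^sup>2 - 3 * \<alpha> + 4) * b - 2 * p * (2 - \<alpha>)\<^sup>2) * b * x\<^sup>2 - 2 * q * a * (2 - \<alpha>)\<^sup>2"
  shows "(D \<noteq> 0 \<longrightarrow> norm a\<^sub>2 \<le> \<bar>b * x\<bar> * sqrt (2 * \<bar>b * x\<bar>) / sqrt \<bar>D\<bar>) \<and>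
         (b * x \<noteq> 0 \<or> q * a = 0 \<longrightarrow>
            norm a\<^sub>3 \<le> \<bar>b * x\<bar> / (6 - 4 * \<alpha>) + b\<^sup>2 * x\<^sup>2 / (2 - \<alpha>)\<^sup>2) \<and>
         (\<forall>\<nu>::real.
            (b * x \<noteq> 0 \<and> \<bar>\<nu> - 1\<bar> \<le> \<bar>D\<bar> / (4 * b\<^sup>2 * x\<^sup>2 * (3 - 2 * \<alpha>)) \<longrightarrow>
               norm (a\<^sub>3 - of_real \<nu> * a\<^sub>2\<^sup>2) \<le> \<bar>b * x\<bar> / (6 - 4 * \<alpha>)) \<and>
            (b * x \<noteq> 0 \<and> D \<noteq> 0 \<and> \<bar>\<nu> - 1\<bar> \<ge> \<bar>D\<bar> / (4 * b\<^sup>2 * x\<^sup>2 * (3 - 2 * \<alpha>)) \<longrightarrow>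
               norm (a\<^sub>3 - of_real \<nu> * a\<^sub>2\<^sup>2) \<le> 2 * \<bar>b * x\<bar> ^ 3 * \<bar>\<nu> - 1\<bar> / \<bar>D\<bar>))"
proof -
  \<comment> \<open>\<open>h\<close> and \<open>k\<close> are coefficients 1 and 2 of the generating
    function. \<open>K\<close> is the factor of \<open>a\<^sub>2\<^sup>2\<close> in the sum of the
    two second-order equations.\<close>
  define h where "h = b * x"
  define k where "k = p * b * x\<^sup>2 + q * a"
  define K where "K = \<alpha>\<^sup>2 - 3 * \<alpha> + 4"
  have D: "D = K * h\<^sup>2 - 2 * k * (2 - \<alpha>)\<^sup>2"
    unfolding assms(6) h_def k_def K_def by (simp add: algebra_simps power2_eq_square)
  have pos: "2 - \<alpha> > 0" "6 - 4 * \<alpha> > 0" "3 - 2 * \<alpha> > 0" using assms(2) by auto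
  obtain c\<^sub>1 c\<^sub>2 d\<^sub>1 d\<^sub>2 :: complex where
    bounds: "norm c\<^sub>1 \<le> 1" "norm c\<^sub>2 \<le> 1" "norm d\<^sub>1 \<le> 1" "norm d\<^sub>2 \<le> 1" and
    eqs: "of_real (2 - \<alpha>) * a\<^sub>2 = of_real h * c\<^sub>1"
    "of_real (2 - \<alpha>) * (- a\<^sub>2) = of_real h * d\<^sub>1"
    "of_real (6 - 4 * \<alpha>) * a\<^sub>3 + of_real ((\<alpha>\<^sup>2 + 5 * \<alpha> - 8) / 2) * a\<^sub>2\<^sup>2 =
       of_real h * c\<^sub>2 + of_real k * c\<^sub>1\<^sup>2"
    "of_real (6 - 4 * \<alpha>) * (2 * a\<^sub>2\<^sup>2 - a\<^sub>3) + of_real ((\<alpha>\<^sup>2 + 5 * \<alpha> - 8) / 2) * a\<^sub>2\<^sup>2 =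
       of_real h * d\<^sub>2 + of_real k * d\<^sub>1\<^sup>2"
    using class_L_coeff_equations[OF assms(3)] unfolding h_def k_def assms(4,5) by metis
  \<comment> \<open>This cancels the \<open>k\<close> terms in the difference. If
    \<open>h = 0\<close> and \<open>k \<noteq> 0\<close>, then \<open>a\<^sub>2 = 0\<close> and the
    sum of the second-order equations gives \<open>d\<^sub>1\<^sup>2 = - c\<^sub>1\<^sup>2\<close>
    instead, so the terms reinforce each other.\<close>
  have kd: "of_real k * d\<^sub>1\<^sup>2 = of_real k * c\<^sub>1\<^sup>2" if "h \<noteq> 0 \<or> k = 0"
  proof (cases "k = 0")
    case False
    have "of_real h * c\<^sub>1 = of_real h * (- d\<^sub>1)"
      using eqs(1,2) by (metis minus_minus mult_minus_right)
    hence "c\<^sub>1 = - d\<^sub>1" using that False by (metis mult_cancel_left of_real_eq_0_iff)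
    thus ?thesis by simp
  qed simp
  have diff: "a\<^sub>3 - a\<^sub>2\<^sup>2 = of_real (h / (2 * (6 - 4 * \<alpha>))) * (c\<^sub>2 - d\<^sub>2)" if "h \<noteq> 0 \<or> k = 0"
  proof -
    have "2 * of_real (6 - 4 * \<alpha>) * (a\<^sub>3 - a\<^sub>2\<^sup>2) = of_real h * (c\<^sub>2 - d\<^sub>2)"
      using eqs(3,4) kd[OF that] by algebra
    moreover have "of_real (6 - 4 * \<alpha>) \<noteq> (0::complex)" using pos by (simp only: of_real_eq_0_iff)
    ultimately show ?thesis by (simp only: of_real_divide of_real_mult of_real_numeral) (simp add: field_simps)
  qed
  have sum: "of_real D * a\<^sub>2\<^sup>2 = of_real h ^ 3 * (c\<^sub>2 + d\<^sub>2)" if "h \<noteq> 0"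
  proof -
    have K: "of_real K * a\<^sub>2\<^sup>2 = of_real h * (c\<^sub>2 + d\<^sub>2) + 2 * of_real k * c\<^sub>1\<^sup>2"
    proof -
      have "of_real K = 2 * of_real (6 - 4 * \<alpha>) + 2 * complex_of_real ((\<alpha>\<^sup>2 + 5 * \<alpha> - 8) / 2)"
        by (simp add: K_def field_simps)
      thus ?thesis using eqs(3,4) kd[OF disjI1[OF that]] by algebra
    qed
    \<comment> \<open>Multiply \<open>K\<close> by \<open>h\<^sup>2\<close> and replace
      \<open>h * c\<^sub>1\<close> by \<open>(2 - \<alpha>) * a\<^sub>2\<close>: the
      \<open>k\<close> term becomes a multiple of \<open>a\<^sub>2\<^sup>2\<close>, and moving it to
      the left turns the factor into \<open>D\<close>.\<close>
    have "of_real D = of_real K * of_real h ^ 2 - 2 * of_real k * (complex_of_real (2 - \<alpha>))\<^sup>2"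
      by (simp add: D)
    thus ?thesis using K eqs(1) by algebra
  qed
  \<comment> \<open>This cruder bound supplies the second summand of the estimate for
    \<open>a\<^sub>3\<close> and forces \<open>a\<^sub>2 = 0\<close> when
    \<open>h = 0\<close>.\<close>
  have a2: "norm a\<^sub>2 \<le> \<bar>h\<bar> / (2 - \<alpha>)"
  proof -
    have "(2 - \<alpha>) * norm a\<^sub>2 = \<bar>h\<bar> * norm c\<^sub>1"
      using arg_cong[OF eqs(1), of norm] pos by (simp only: norm_mult norm_of_real)
    also have "\<dots> \<le> \<bar>h\<bar>" using bounds by (intro mult_left_le) auto
    finally show ?thesis using pos by (simp add: field_simps)
  qed
  have diff_le: "norm (a\<^sub>3 - a\<^sub>2\<^sup>2) \<le> \<bar>h\<bar> / (6 - 4 * \<alpha>)" if "h \<noteq> 0 \<or> k = 0"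
  proof -
    have "norm (c\<^sub>2 - d\<^sub>2) \<le> 2" using norm_triangle_ineq4[of c\<^sub>2 d\<^sub>2] bounds by linarith
    moreover have "norm (a\<^sub>3 - a\<^sub>2\<^sup>2) = \<bar>h\<bar> * norm (c\<^sub>2 - d\<^sub>2) / (2 * (6 - 4 * \<alpha>))"
      unfolding diff[OF that] norm_mult norm_of_real using pos by (simp add: abs_divide)
    ultimately have "norm (a\<^sub>3 - a\<^sub>2\<^sup>2) \<le> \<bar>h\<bar> * 2 / (2 * (6 - 4 * \<alpha>))"
      using pos by (simp only:) (intro divide_right_mono mult_left_mono; simp)
    also have "\<dots> = \<bar>h\<bar> / (6 - 4 * \<alpha>)" using pos by (simp only: mult.commute[of _ 2]) (rule mult_divide_mult_cancel_left, simp)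
    finally show ?thesis .
  qed
  \<comment> \<open>One bound serves both ranges of \<nu>. Splitting off
    \<open>(1 - \<nu>) * a\<^sub>2\<^sup>2\<close> gives \<open>c\<^sub>2\<close> and
    \<open>d\<^sub>2\<close> the weights \<open>u + t\<close> and \<open>u - t\<close> up to the
    factor \<open>h\<close>, and the absolute values of these weights add up to twice the larger of
    \<open>\<bar>u\<bar>\<close> and \<open>t\<close>. The threshold for \<nu> is where these two
    are equal.\<close>
  have fs: "norm (a\<^sub>3 - of_real \<nu> * a\<^sub>2\<^sup>2) \<le> 2 * \<bar>h\<bar> * max (\<bar>\<nu> - 1\<bar> * h\<^sup>2 / \<bar>D\<bar>) (1 / (2 * (6 - 4 * \<alpha>)))"
    if "h \<noteq> 0" "D \<noteq> 0" for \<nu>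
  proof -
    define u where "u = (1 - \<nu>) * h\<^sup>2 / D"
    define t where "t = 1 / (2 * (6 - 4 * \<alpha>))"
    have "a\<^sub>2\<^sup>2 = of_real (h ^ 3 / D) * (c\<^sub>2 + d\<^sub>2)"
      using sum that by (simp add: field_simps)
    moreover have "a\<^sub>3 - of_real \<nu> * a\<^sub>2\<^sup>2 = (a\<^sub>3 - a\<^sub>2\<^sup>2) + of_real (1 - \<nu>) * a\<^sub>2\<^sup>2"
      by (simp add: algebra_simps)
    moreover have "h / (2 * (6 - 4 * \<alpha>)) = h * t" "(1 - \<nu>) * (h ^ 3 / D) = h * u"
      by (simp_all add: t_def u_def power3_eq_cube power2_eq_square)
    ultimately have "a\<^sub>3 - of_real \<nu> * a\<^sub>2\<^sup>2 = of_real (h * t) * (c\<^sub>2 - d\<^sub>2) + of_real (h * u) * (c\<^sub>2 + d\<^sub>2)"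
      using diff that by (simp only: mult.assoc[symmetric] of_real_mult[symmetric] simp_thms)
    also have "\<dots> = of_real h * (of_real (u + t) * c\<^sub>2 + of_real (u - t) * d\<^sub>2)"
      by (simp add: algebra_simps)
    finally have eq: "norm (a\<^sub>3 - of_real \<nu> * a\<^sub>2\<^sup>2) =
        \<bar>h\<bar> * norm (of_real (u + t) * c\<^sub>2 + of_real (u - t) * d\<^sub>2)"
      by (simp only: norm_mult norm_of_real)
    have "norm (of_real (u + t) * c\<^sub>2 + of_real (u - t) * d\<^sub>2) \<le> \<bar>u + t\<bar> * norm c\<^sub>2 + \<bar>u - t\<bar> * norm d\<^sub>2"
      by (rule order_trans[OF norm_triangle_ineq]) (simp only: norm_mult norm_of_real order_refl)
    also have "\<dots> \<le> \<bar>u + t\<bar> + \<bar>u - t\<bar>"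
      using bounds by (intro add_mono mult_left_le) auto
    also have "\<dots> = 2 * max \<bar>u\<bar> t"
    proof -
      have "t > 0" using pos by (simp add: t_def)
      thus ?thesis by linarith
    qed
    also have "\<bar>u\<bar> = \<bar>\<nu> - 1\<bar> * h\<^sup>2 / \<bar>D\<bar>" by (simp add: u_def abs_mult abs_minus_commute)
    finally have "\<bar>h\<bar> * norm (of_real (u + t) * c\<^sub>2 + of_real (u - t) * d\<^sub>2) \<le>
        \<bar>h\<bar> * (2 * max (\<bar>\<nu> - 1\<bar> * h\<^sup>2 / \<bar>D\<bar>) t)"
      by (rule mult_left_mono) simp
    thus ?thesis unfolding eq t_def by (simp only: mult.assoc mult.left_commute[of _ 2])
  qed
  have "norm a\<^sub>2 \<le> \<bar>h\<bar> * sqrt (2 * \<bar>h\<bar>) / sqrt \<bar>D\<bar>" if "D \<noteq> 0"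
  proof (cases "h = 0")
    case False
    have "\<bar>D\<bar> * (norm a\<^sub>2)\<^sup>2 = \<bar>h\<bar> ^ 3 * norm (c\<^sub>2 + d\<^sub>2)"
      using arg_cong[OF sum[OF False], of norm] by (simp only: norm_mult norm_power norm_of_real)
    also have "\<dots> \<le> \<bar>h\<bar> ^ 3 * 2"
      using norm_triangle_ineq[of c\<^sub>2 d\<^sub>2] bounds by (intro mult_left_mono) auto
    \<comment> \<open>The cube is split as \<open>\<bar>h\<bar>\<^sup>2 * \<bar>h\<bar>\<close> so
      that the square root releases a factor \<open>\<bar>h\<bar>\<close>.\<close>
    finally have "(norm a\<^sub>2)\<^sup>2 \<le> \<bar>h\<bar>\<^sup>2 * (2 * \<bar>h\<bar>) / \<bar>D\<bar>"
      using that by (simp add: field_simps power3_eq_cube power2_eq_square)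
    hence "norm a\<^sub>2 \<le> sqrt (\<bar>h\<bar>\<^sup>2 * (2 * \<bar>h\<bar>) / \<bar>D\<bar>)" by (rule real_le_rsqrt)
    thus ?thesis by (simp add: real_sqrt_divide real_sqrt_mult)
  qed (use a2 in simp)
  moreover have "norm a\<^sub>3 \<le> \<bar>h\<bar> / (6 - 4 * \<alpha>) + h\<^sup>2 / (2 - \<alpha>)\<^sup>2" if "h \<noteq> 0 \<or> q * a = 0"
  proof -
    \<comment> \<open>For \<open>h = 0\<close> the summand \<open>p * b * x\<^sup>2\<close> of
      \<open>k\<close> vanishes, leaving \<open>k = q * a\<close>.\<close>
    have "h \<noteq> 0 \<or> k = 0" using that by (auto simp: h_def k_def)
    hence "norm (a\<^sub>3 - a\<^sub>2\<^sup>2) \<le> \<bar>h\<bar> / (6 - 4 * \<alpha>)" by (rule diff_le)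
    moreover have "norm (a\<^sub>2\<^sup>2) \<le> h\<^sup>2 / (2 - \<alpha>)\<^sup>2"
      using power_mono[OF a2, of 2] by (simp add: norm_power power_divide)
    ultimately show ?thesis using norm_triangle_ineq[of "a\<^sub>3 - a\<^sub>2\<^sup>2" "a\<^sub>2\<^sup>2"] by simp
  qed
  moreover have "norm (a\<^sub>3 - of_real \<nu> * a\<^sub>2\<^sup>2) \<le> \<bar>h\<bar> / (6 - 4 * \<alpha>)"
    if "h \<noteq> 0" "\<bar>\<nu> - 1\<bar> \<le> \<bar>D\<bar> / (4 * h\<^sup>2 * (3 - 2 * \<alpha>))" for \<nu>
  proof (cases "D = 0")
    \<comment> \<open>The threshold is then 0, so \<nu> = 1 and the claim is
      \<open>diff_le\<close>.\<close>
    case True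
    thus ?thesis using diff_le that by simp
  next
    case False
    \<comment> \<open>The condition on \<nu> rearranged: the maximum in \<open>fs\<close> is its
      second, constant argument.\<close>
    have "\<bar>\<nu> - 1\<bar> * h\<^sup>2 / \<bar>D\<bar> \<le> 1 / (2 * (6 - 4 * \<alpha>))"
      using that False pos by (simp add: field_simps)
    hence "norm (a\<^sub>3 - of_real \<nu> * a\<^sub>2\<^sup>2) \<le> 2 * \<bar>h\<bar> * (1 / (2 * (6 - 4 * \<alpha>)))"
      using fs[OF that(1) False, of \<nu>] by (simp only: max_absorb2)
    also have "\<dots> = \<bar>h\<bar> / (6 - 4 * \<alpha>)"
      by (metis mult_divide_mult_cancel_left mult.right_neutral times_divide_eq_right zero_neq_numeral)
    finally show ?thesis .
  qed
  moreover have "norm (a\<^sub>3 - of_real \<nu> * a\<^sub>2\<^sup>2) \<le> 2 * \<bar>h\<bar> ^ 3 * \<bar>\<nu> - 1\<bar> / \<bar>D\<bar>"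
    if "h \<noteq> 0" "D \<noteq> 0" "\<bar>\<nu> - 1\<bar> \<ge> \<bar>D\<bar> / (4 * h\<^sup>2 * (3 - 2 * \<alpha>))" for \<nu>
  proof -
    \<comment> \<open>Beyond the threshold the argument depending on \<nu> dominates the
      maximum.\<close>
    have "\<bar>\<nu> - 1\<bar> * h\<^sup>2 / \<bar>D\<bar> \<ge> 1 / (2 * (6 - 4 * \<alpha>))"
      using that pos by (simp add: field_simps)
    hence "norm (a\<^sub>3 - of_real \<nu> * a\<^sub>2\<^sup>2) \<le> 2 * \<bar>h\<bar> * (\<bar>\<nu> - 1\<bar> * \<bar>h\<bar>\<^sup>2 / \<bar>D\<bar>)"
      using fs[OF that(1,2), of \<nu>] by (simp add: max_absorb1)
    thus ?thesis by (simp only: power3_eq_cube power2_eq_square) (simp add: mult_ac)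
  qed
  ultimately show ?thesis
    unfolding h_def by (simp add: power_mult_distrib mult.assoc)
qed

end
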